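(* Consider an imprecise Markov chain with marginal lower expectation $\underline{E}_1$ and lower transition operator $\underline{\mathrm{T}}$ that is Perron–Frobenius-like with stationary lower expectation $\underline{E}_\infty$. Then the imprecise Markov chain is stationary if and only if $\underline{E}_\infty=\underline{E}_1$.
   Context: Write $\mathbb{N}=\{1,2,\dots\}$, $\mathbb{N}_0=\mathbb{N}\cup\{0\}$. Let $\mathcal{X}$ be a non-empty finite set (state space). A situation is a finite string $x_{1:n}=(x_1,\dots,x_n)\in\mathcal{X}^n$, $n\in\mathbb{N}_0$; the empty string is $\square$. A path is an element $\omega=(\omega_1,\omega_2,\dots)$ of $\Omega:=\mathcal{X}^{\mathbb{N}}$; $\omega^n:=(\omega_1,\dots,\omega_n)$. An extended real variable is a map $\Omega\to\mathbb{R}\cup\{-\infty,+\infty\}$. A gamble on a set $Y$ is a bounded function $Y\to\mathbb{R}$; $\mathcal{G}(Y)$ is the set of these. A lower expectation on $\mathcal{G}(Y)$ is a functional $\underline{E}\colon\mathcal{G}(Y)\to\mathbb{R}$ with $\underline{E}(f)\geq\inf f$, $\underline{E}(f+g)\geq\underline{E}(f)+\underline{E}(g)$ and $\underline{E}(\lambda f)=\lambda\underline{E}(f)$ for all gambles $f,g$ and real $\lambda\geq0$. An imprecise Markov chain attaches to each situation $x_{1:n}$ a lower expectation $\underline{Q}(\cdot|x_{1:n})$ on $\mathcal{G}(\mathcal{X})$ such that $\underline{Q}(\cdot|x_{1:n})=\underline{Q}(\cdot|x_n)$ for all $n\in\mathbb{N}$ and $x_{1:n}\in\mathcal{X}^n$.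 Its marginal model is $\underline{E}_1:=\underline{Q}(\cdot|\square)$, and its lower transition operator $\underline{\mathrm{T}}\colon\mathcal{G}(\mathcal{X})\to\mathcal{G}(\mathcal{X})$ is $\underline{\mathrm{T}}f(x):=\underline{Q}(f|x)$. $\underline{\mathrm{T}}$ is Perron–Frobenius-like if for every $f\in\mathcal{G}(\mathcal{X})$ the sequence $\underline{\mathrm{T}}^nf$ converges point-wise to a constant real number, denoted $\underline{E}_\infty(f)$; $\underline{E}_\infty$ is then a lower expectation, and it is the only lower expectation on $\mathcal{G}(\mathcal{X})$ with $\underline{E}_\infty\circ\underline{\mathrm{T}}=\underline{E}_\infty$. Both $\underline{E}_1$ and $\underline{E}_\infty$ are extended to maps $g\colon\mathcal{X}\to\mathbb{R}\cup\{-\infty,+\infty\}$ by $\underline{E}_i(g):=\sup\{\underline{E}_i(h):h\in\mathcal{G}(\mathcal{X}),h\leq g\}$, so equality on gambles is equivalent to equality of the extensions. A real process is a real-valued map $\mathcal{F}$ on situations; $\Delta\mathcal{F}(x_{1:n})(x_{n+1}):=\mathcal{F}(x_{1:n+1})-\mathcal{F}(x_{1:n})$. A submartingale is a real process $\mathcal{M}$ with $\underline{Q}(\Delta\mathcal{M}(t)|t)\geq0$ for all situations $t$. For an extended real variable $f$, the global lower expectation is $$\underline{E}(f):=\sup\{\mathcal{M}(\square):\mathcal{M}\text{ a bounded above submartingale with }\limsup_{n\to\infty}\mathcal{M}(\omega^n)\leq f(\omega)\text{ for all }\omega\in\Omega\},$$ with $\sup\emptyset=-\infty$. The shift $\theta$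 acts on paths by $(\theta\omega)_n:=\omega_{n+1}$ and on variables by $(\theta f)(\omega):=f(\theta\omega)$. The imprecise Markov chain is stationary if $\underline{E}(f)=\underline{E}(\theta f)$ for all extended real variables $f$. *)

theory Defs
  imports "HOL-Analysis.Analysis"
begin

text \<open>
  The state space is a type \<open>'a :: finite\<close> (types are non-empty). Hence every function
  \<open>'a \<Rightarrow> real\<close> is bounded, and the gambles on the state space are all of \<open>'a \<Rightarrow> real\<close>;
  see the lemma \<open>gamble_bounded\<close> below.
\<close>

type_synonym 'a gamble = "'a \<Rightarrow> real"

text \<open>A situation lists the states in chronological order, so its last state is \<open>last s\<close>.\<close>

type_synonym 'a situation = "'a list"

text \<open>Paths are indexed from 0: the state at time \<open>n + 1\<close> of a path \<open>\<omega>\<close> is \<open>\<omega> n\<close>.\<close>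

type_synonym 'a path = "nat \<Rightarrow> 'a"

lemma gamble_bounded:
  fixes f :: "'a::finite gamble"
  shows "bounded (range f)"
  by (simp add: finite_imp_bounded)

definition lower_expectation :: "('a::finite gamble \<Rightarrow> real) \<Rightarrow> bool" where
  "lower_expectation E \<longleftrightarrow>
     (\<forall>f. E f \<ge> (INF x. f x)) \<and>
     (\<forall>f g. E (\<lambda>x. f x + g x) \<ge> E f + E g) \<and>
     (\<forall>f c. c \<ge> 0 \<longrightarrow> E (\<lambda>x. c * f x) = c * E f)"

text \<open>The local model at the situation \<open>s\<close> is \<open>Q s\<close>.\<close>

definition imprecise_markov_chain ::
  "('a::finite situation \<Rightarrow> 'a gamble \<Rightarrow> real) \<Rightarrow> bool" where
  "imprecise_markov_chain Q \<longleftrightarrow>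
     (\<forall>s. lower_expectation (Q s)) \<and> (\<forall>s. s \<noteq> [] \<longrightarrow> Q s = Q [last s])"

definition marginal_model ::
  "('a situation \<Rightarrow> 'a gamble \<Rightarrow> real) \<Rightarrow> 'a gamble \<Rightarrow> real" where
  "marginal_model Q = Q []"

definition lower_transition ::
  "('a situation \<Rightarrow> 'a gamble \<Rightarrow> real) \<Rightarrow> 'a gamble \<Rightarrow> 'a gamble" where
  "lower_transition Q f = (\<lambda>x. Q [x] f)"

definition perron_frobenius_like :: "('a gamble \<Rightarrow> 'a gamble) \<Rightarrow> bool" where
  "perron_frobenius_like T \<longleftrightarrow> (\<forall>f. \<exists>c. \<forall>x. (\<lambda>n. (T ^^ n) f x) \<longlonglongrightarrow> c)"

text \<open>Meaningful only if \<open>perron_frobenius_like T\<close>; the limit is then unique.\<close>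

definition limit_expectation :: "('a gamble \<Rightarrow> 'a gamble) \<Rightarrow> 'a gamble \<Rightarrow> real" where
  "limit_expectation T f = (THE c. \<forall>x. (\<lambda>n. (T ^^ n) f x) \<longlonglongrightarrow> c)"

lemma limit_expectation:
  assumes "perron_frobenius_like T"
  shows "(\<lambda>n. (T ^^ n) f x) \<longlonglongrightarrow> limit_expectation T f"
proof -
  have "\<exists>!c. \<forall>x. (\<lambda>n. (T ^^ n) f x) \<longlonglongrightarrow> c"
    using assms unfolding perron_frobenius_like_def by (blast intro: LIMSEQ_unique)
  from theI'[OF this] show ?thesis
    unfolding limit_expectation_def by blast
qed

definition process_difference :: "('a situation \<Rightarrow> real) \<Rightarrow> 'a situation \<Rightarrow> 'a gamble" where
  "process_difference F s = (\<lambda>x. F (s @ [x]) - F s)"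

definition submartingale ::
  "('a situation \<Rightarrow> 'a gamble \<Rightarrow> real) \<Rightarrow> ('a situation \<Rightarrow> real) \<Rightarrow> bool" where
  "submartingale Q M \<longleftrightarrow> (\<forall>s. Q s (process_difference M s) \<ge> 0)"

definition path_prefix :: "'a path \<Rightarrow> nat \<Rightarrow> 'a situation" where
  "path_prefix \<omega> n = map \<omega> [0..<n]"

text \<open>In \<open>ereal\<close>, the supremum of the empty set is \<open>-\<infinity>\<close>.\<close>

definition global_lower_expectation ::
  "('a situation \<Rightarrow> 'a gamble \<Rightarrow> real) \<Rightarrow> ('a path \<Rightarrow> ereal) \<Rightarrow> ereal" where
  "global_lower_expectation Q f =
     Sup {ereal (M []) | M. submartingale Q M \<and> bdd_above (range M) \<and>
            (\<forall>\<omega>. limsup (\<lambda>n. ereal (M (path_prefix \<omega> n))) \<le> f \<omega>)}"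

definition path_shift :: "'a path \<Rightarrow> 'a path" where
  "path_shift \<omega> = (\<lambda>n. \<omega> (Suc n))"

definition stationary_chain ::
  "('a situation \<Rightarrow> 'a gamble \<Rightarrow> real) \<Rightarrow> bool" where
  "stationary_chain Q \<longleftrightarrow>
     (\<forall>f. global_lower_expectation Q f = global_lower_expectation Q (\<lambda>\<omega>. f (path_shift \<omega>)))"

text \<open>
  The extension of a lower expectation to extended real maps. Equality of the extensions is
  the same as equality on gambles, so it is enough to compare lower expectations on gambles.
\<close>

definition extended_expectation :: "('a gamble \<Rightarrow> real) \<Rightarrow> ('a \<Rightarrow> ereal) \<Rightarrow> ereal" where
  "extended_expectation E g = Sup {ereal (E h) | h. \<forall>x. ereal (h x) \<le> g x}"

lemma lower_expectation_mono:
  assumes E: "lower_expectation E" and le: "\<And>x. f x \<le> g x"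
  shows "E f \<le> E g"
proof -
  have "0 \<le> (INF x. g x - f x)"
    using le by (intro cINF_greatest) auto
  also have "\<dots> \<le> E (\<lambda>x. g x - f x)"
    using E unfolding lower_expectation_def by blast
  finally have "E f \<le> E f + E (\<lambda>x. g x - f x)" by simp
  also have "\<dots> \<le> E (\<lambda>x. f x + (g x - f x))"
    using E unfolding lower_expectation_def by blast
  finally show ?thesis by simp
qed

lemma extended_expectation_gamble:
  assumes "lower_expectation E"
  shows "extended_expectation E (\<lambda>x. ereal (f x)) = ereal (E f)"
  unfolding extended_expectation_def
  by (rule Sup_eqI) (auto intro!: lower_expectation_mono[OF assms])

lemma extended_expectation_eq_iff:
  assumes "lower_expectation E" "lower_expectation F"
  shows "extended_expectation E = extended_expectation F \<longleftrightarrow> E = F"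
  by (metis assms extended_expectation_gamble ereal.inject ext)

end

theory Submission
  imports Defs
begin

text \<open>
  Write \<open>E\<^sub>1\<close> for the marginal model, \<open>T\<close> for the lower transition operator. Both conditions
  are equivalent to \<open>E\<^sub>1 \<circ> T = E\<^sub>1\<close>; for stationarity this is \<open>stationary_chain_iff_invariant\<close>,
  which needs no convergence of \<open>T\<^sup>n\<close>.

  That \<open>E\<^sub>1 \<circ> T = E\<^sub>1\<close> is equivalent to \<open>E\<^sub>1\<close> being the limit expectation is elementary: the limit of
  \<open>T\<^sup>n f\<close> does not change when \<open>f\<close> is replaced by \<open>T f\<close>, and conversely
  \<open>E\<^sub>1 f = E\<^sub>1 (T\<^sup>n f)\<close>, where \<open>T\<^sup>n f\<close> tends to a constant, uniformly because there are finitely many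
  states (\<open>limit_expectation_eq_iff_invariant\<close>).

  A stationary chain satisfies \<open>E\<^sub>1 \<circ> T = E\<^sub>1\<close> because the global lower expectations of \<open>h(X\<^sub>1)\<close>
  and \<open>h(X\<^sub>2)\<close>, where \<open>X\<^sub>1 = \<omega> 0\<close> and \<open>X\<^sub>2 = \<omega> 1\<close>, are \<open>E\<^sub>1 h\<close> and \<open>E\<^sub>1 (T h)\<close>.
  Both values come from backward recursion (\<open>global_lower_expectation_backward\<close>), whose upper bound rests on the fact that from every
  situation some path leads on along which a given submartingale stays above its value there.

  Conversely, if \<open>E\<^sub>1 \<circ> T = E\<^sub>1\<close>, submartingales are transported between \<open>f\<close> and its shift without
  lowering the initial value. One that is admissible for \<open>f\<close> is delayed by one step, with \<open>T\<close>
  supplying the additional local model. One \<open>M\<close> that is admissible for the shift of \<open>f\<close> becomes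
  admissible for \<open>f\<close> by erasing the first state: after \<open>y\<close>, follow \<open>M\<close> on the branch that begins
  with an \<open>x\<close> for which \<open>M [x, y]\<close> is largest. Thus \<open>f\<close> may be an arbitrary extended real variable,
  and no continuity property of the global lower expectation is needed.
\<close>

section \<open>Lower expectations and constants\<close>

lemma lower_expectation_const:
  assumes E: "lower_expectation E"
  shows "E (\<lambda>x. c) = c"
proof -
  have lower: "b \<le> E (\<lambda>x. b)" for b
  proof -
    have "(INF x::'a. b) \<le> E (\<lambda>x. b)"
      using E unfolding lower_expectation_def by blast
    then show ?thesis by simp
  qed
  have "\<forall>f b. b \<ge> 0 \<longrightarrow> E (\<lambda>x. b * f x) = b * E f"
    using E unfolding lower_expectation_def by blast
  from this[rule_format, of 0 "\<lambda>x. c"] have "E (\<lambda>x. 0) = 0"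
    by simp
  moreover have "E (\<lambda>x. c) + E (\<lambda>x. - c) \<le> E (\<lambda>x. c + - c)"
    using E unfolding lower_expectation_def by blast
  ultimately show ?thesis
    using lower[of c] lower[of "- c"] by simp
qed

lemma lower_expectation_diff_const:
  assumes E: "lower_expectation E"
  shows "E (\<lambda>x. f x - c) = E f - c"
proof -
  have superadd: "E g + E h \<le> E (\<lambda>x. g x + h x)" for g h
    using E unfolding lower_expectation_def by blast
  show ?thesis
    using superadd[of f "\<lambda>x. - c"] superadd[of "\<lambda>x. f x - c" "\<lambda>x. c"]
    by (simp add: lower_expectation_const[OF E])
qed

lemma lower_expectation_le_constD:
  assumes "lower_expectation E" "\<And>x. f x \<le> c"
  shows "E f \<le> c"
  using lower_expectation_mono[OF assms(1), of f "\<lambda>x. c"] assms(2)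
  by (simp add: lower_expectation_const[OF assms(1)])

lemma lower_expectation_ge_constD:
  assumes "lower_expectation E" "\<And>x. c \<le> f x"
  shows "c \<le> E f"
  using lower_expectation_mono[OF assms(1), of "\<lambda>x. c" f] assms(2)
  by (simp add: lower_expectation_const[OF assms(1)])

section \<open>Invariance of the marginal model under the transition operator\<close>

lemma limit_expectation_lower_transition:
  assumes "perron_frobenius_like T"
  shows "limit_expectation T (T f) = limit_expectation T f"
proof -
  have "(\<lambda>n. (T ^^ Suc n) f x) \<longlonglongrightarrow> limit_expectation T f" for x
    using limit_expectation[OF assms] by (rule LIMSEQ_Suc)
  then have "(\<lambda>n. (T ^^ n) (T f) x) \<longlonglongrightarrow> limit_expectation T f" for x
    by (simp add: funpow_swap1)
  then show ?thesis
    using limit_expectation[OF assms] by (rule LIMSEQ_unique[rotated])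
qed

lemma invariant_imp_eq_limit_expectation:
  assumes E: "lower_expectation E" and pf: "perron_frobenius_like T"
    and inv: "\<And>h. E (T h) = E h"
  shows "E f = limit_expectation T f"
proof -
  let ?c = "limit_expectation T f"
  have iter: "E ((T ^^ n) f) = E f" for n
    by (induction n) (simp_all add: inv)
  have close: "\<bar>E f - ?c\<bar> \<le> e" if "e > 0" for e
  proof -
    have "\<forall>\<^sub>F n in sequentially. dist ((T ^^ n) f x) ?c < e" for x
      using limit_expectation[OF pf] that by (rule tendstoD)
    then have "\<forall>\<^sub>F n in sequentially. \<forall>x. dist ((T ^^ n) f x) ?c < e"
      by (rule eventually_all_finite)
    then obtain n where n: "\<bar>(T ^^ n) f x - ?c\<bar> < e" for x
      by (auto simp: eventually_sequentially dist_real_def)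
    have "?c - e \<le> E ((T ^^ n) f)"
      using n by (intro lower_expectation_ge_constD[OF E]) (smt (verit))
    moreover have "E ((T ^^ n) f) \<le> ?c + e"
      using n by (intro lower_expectation_le_constD[OF E]) (smt (verit))
    ultimately show ?thesis
      by (simp add: iter abs_le_iff)
  qed
  have "\<bar>E f - ?c\<bar> \<le> 0"
    by (rule field_le_epsilon) (simp add: close)
  then show ?thesis by simp
qed

lemma limit_expectation_eq_iff_invariant:
  assumes "lower_expectation E" "perron_frobenius_like T"
  shows "limit_expectation T = E \<longleftrightarrow> (\<forall>h. E (T h) = E h)"
  using invariant_imp_eq_limit_expectation[OF assms]
    limit_expectation_lower_transition[OF assms(2)] by fastforce

section \<open>Submartingales and backward recursion\<close>

text \<open>The defining condition without process differences.\<close>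

lemma submartingale_iff:
  assumes "\<And>s. lower_expectation (Q s)"
  shows "submartingale Q M \<longleftrightarrow> (\<forall>s. M s \<le> Q s (\<lambda>x. M (s @ [x])))"
  by (simp add: submartingale_def process_difference_def lower_expectation_diff_const[OF assms])

text \<open>The submartingales over which the supremum in the global lower expectation is taken.\<close>

definition admissible_submartingale ::
  "('a situation \<Rightarrow> 'a gamble \<Rightarrow> real) \<Rightarrow> ('a path \<Rightarrow> ereal) \<Rightarrow> ('a situation \<Rightarrow> real) \<Rightarrow> bool" where
  "admissible_submartingale Q f M \<longleftrightarrow> submartingale Q M \<and> bdd_above (range M) \<and>
     (\<forall>\<omega>. limsup (\<lambda>n. ereal (M (path_prefix \<omega> n))) \<le> f \<omega>)"

lemma global_lower_expectation_upper:
  "admissible_submartingale Q f M \<Longrightarrow> ereal (M []) \<le> global_lower_expectation Q f"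
  unfolding global_lower_expectation_def admissible_submartingale_def by (blast intro: Sup_upper)

lemma global_lower_expectation_least:
  assumes "\<And>M. admissible_submartingale Q f M \<Longrightarrow> ereal (M []) \<le> b"
  shows "global_lower_expectation Q f \<le> b"
  unfolding global_lower_expectation_def
  by (rule Sup_least) (use assms in \<open>auto simp: admissible_submartingale_def\<close>)

lemma path_prefix_Suc: "path_prefix \<omega> (Suc n) = path_prefix \<omega> n @ [\<omega> n]"
  by (simp add: path_prefix_def)

lemma path_prefix_Suc_shift: "path_prefix \<omega> (Suc n) = \<omega> 0 # path_prefix (path_shift \<omega>) n"
  by (induction n) (simp_all add: path_prefix_def path_shift_def)

lemma submartingale_path_above:
  fixes M :: "'a::finite situation \<Rightarrow> real"
  assumes lex: "\<And>s. lower_expectation (Q s)" and sub: "submartingale Q M"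
  obtains \<omega> where "path_prefix \<omega> (length s) = s"
    and "\<And>n. length s \<le> n \<Longrightarrow> M s \<le> M (path_prefix \<omega> n)"
proof -
  have "\<exists>x. M t \<le> M (t @ [x])" for t
  proof (rule ccontr)
    assume "\<not> ?thesis"
    then have less: "M (t @ [x]) < M t" for x
      by (simp add: not_le)
    \<comment> \<open>Finiteness of the state space makes the gap uniform.\<close>
    let ?m = "Max (range (\<lambda>x. M (t @ [x])))"
    have "?m < M t"
      using less by (subst Max_less_iff) auto
    moreover have "Q t (\<lambda>x. M (t @ [x])) \<le> ?m"
      by (rule lower_expectation_le_constD[OF lex]) simp
    moreover have "M t \<le> Q t (\<lambda>x. M (t @ [x]))"
      using sub by (simp add: submartingale_iff[OF lex])
    ultimately show False by linarith
  qed
  then obtain up where up: "M t \<le> M (t @ [up t])" for t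
    by metis
  define g where "g k = ((\<lambda>t. t @ [up t]) ^^ k) s" for k
  define \<omega> where "\<omega> n = (if n < length s then s ! n else up (g (n - length s)))" for n
  have pre: "path_prefix \<omega> (length s) = s"
    by (rule nth_equalityI) (simp_all add: path_prefix_def \<omega>_def)
  have prefix: "path_prefix \<omega> (length s + k) = g k" for k
  proof (induction k)
    case 0
    then show ?case using pre by (simp add: g_def)
  next
    case (Suc k)
    then show ?case by (simp add: path_prefix_Suc g_def \<omega>_def)
  qed
  have "M s \<le> M (g k)" for k
  proof (induction k)
    case (Suc k)
    then show ?case using up[of "g k"] by (simp add: g_def)
  qed (simp add: g_def)
  then have "M s \<le> M (path_prefix \<omega> n)" if "length s \<le> n" for n
    using prefix[of "n - length s"] that by simp
  with pre show ?thesis by (rule that)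
qed

text \<open>
  Backward recursion for a variable that depends on the first \<open>n\<close> states: \<open>Y s\<close> is its
  conditional lower expectation in the situation \<open>s\<close>.
\<close>

lemma global_lower_expectation_backward:
  fixes Q :: "'a::finite situation \<Rightarrow> 'a gamble \<Rightarrow> real"
  assumes lex: "\<And>s. lower_expectation (Q s)"
    and rec: "\<And>s. length s < n \<Longrightarrow> Q s (\<lambda>x. Y (s @ [x])) = Y s"
  shows "global_lower_expectation Q (\<lambda>\<omega>. ereal (Y (path_prefix \<omega> n))) = ereal (Y [])"
proof (rule antisym)
  \<comment> \<open>The recursion, stopped at time \<open>n\<close>, attains the supremum.\<close>
  define M where "M s = Y (take n s)" for s
  have "submartingale Q M"
    unfolding submartingale_iff[OF lex]
  proof
    fix s
    show "M s \<le> Q s (\<lambda>x. M (s @ [x]))"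
    proof (cases "length s < n")
      case True
      then show ?thesis by (simp add: M_def rec)
    next
      case False
      then show ?thesis by (simp add: M_def lower_expectation_const[OF lex])
    qed
  qed
  moreover have "bdd_above (range M)"
  proof -
    have "range M \<subseteq> Y ` {s. set s \<subseteq> UNIV \<and> length s \<le> n}"
      by (auto simp: M_def)
    moreover have "finite (Y ` {s. set s \<subseteq> UNIV \<and> length s \<le> n})"
      by (intro finite_imageI finite_lists_length_le) simp
    ultimately show ?thesis
      by (intro bdd_above_finite) (rule finite_subset)
  qed
  moreover have "limsup (\<lambda>k. ereal (M (path_prefix \<omega> k))) \<le> ereal (Y (path_prefix \<omega> n))" for \<omega>
  proof (rule Limsup_bounded)
    show "\<forall>\<^sub>F k in sequentially. ereal (M (path_prefix \<omega> k)) \<le> ereal (Y (path_prefix \<omega> n))"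
      using eventually_ge_at_top[of n]
      by eventually_elim (simp add: M_def path_prefix_def take_map min_def)
  qed
  ultimately have "ereal (M []) \<le>
      global_lower_expectation Q (\<lambda>\<omega>. ereal (Y (path_prefix \<omega> n)))"
    by (intro global_lower_expectation_upper) (simp add: admissible_submartingale_def)
  then show "ereal (Y []) \<le> global_lower_expectation Q (\<lambda>\<omega>. ereal (Y (path_prefix \<omega> n)))"
    by (simp add: M_def)
next
  show "global_lower_expectation Q (\<lambda>\<omega>. ereal (Y (path_prefix \<omega> n))) \<le> ereal (Y [])"
  proof (rule global_lower_expectation_least)
    fix M
    assume adm: "admissible_submartingale Q (\<lambda>\<omega>. ereal (Y (path_prefix \<omega> n))) M"
    then have sub: "submartingale Q M"
      and lim: "limsup (\<lambda>k. ereal (M (path_prefix \<omega> k))) \<le> ereal (Y (path_prefix \<omega> n))" for \<omega>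
      by (auto simp: admissible_submartingale_def)
    have "M s \<le> Y s" if "length s \<le> n" for s
      using that
    proof (induction "n - length s" arbitrary: s)
      case 0
      then have len: "length s = n" by simp
      obtain \<omega> where \<omega>: "path_prefix \<omega> (length s) = s"
        and up: "\<And>k. length s \<le> k \<Longrightarrow> M s \<le> M (path_prefix \<omega> k)"
        using submartingale_path_above[OF lex sub] by blast
      have "ereal (M s) \<le> limsup (\<lambda>k. ereal (M (path_prefix \<omega> k)))"
        by (rule le_Limsup) (use up in \<open>auto simp: eventually_sequentially\<close>)
      also have "\<dots> \<le> ereal (Y s)"
        using lim[of \<omega>] \<omega> len by simp
      finally show ?case by simp
    next
      case (Suc d)
      then have "M (s @ [x]) \<le> Y (s @ [x])" for x
        by simp
      then have "Q s (\<lambda>x. M (s @ [x])) \<le> Q s (\<lambda>x. Y (s @ [x]))"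
        by (rule lower_expectation_mono[OF lex])
      also have "\<dots> = Y s"
        using Suc.hyps(2) by (simp add: rec)
      finally have "Q s (\<lambda>x. M (s @ [x])) \<le> Y s" .
      moreover have "M s \<le> Q s (\<lambda>x. M (s @ [x]))"
        using sub by (simp add: submartingale_iff[OF lex])
      ultimately show ?case by linarith
    qed
    then show "ereal (M []) \<le> ereal (Y [])" by simp
  qed
qed

lemma global_lower_expectation_first_state:
  fixes Q :: "'a::finite situation \<Rightarrow> 'a gamble \<Rightarrow> real"
  assumes "\<And>s. lower_expectation (Q s)"
  shows "global_lower_expectation Q (\<lambda>\<omega>. ereal (h (\<omega> 0))) = ereal (Q [] h)"
  using global_lower_expectation_backward
    [where Q = Q and n = 1 and Y = "\<lambda>s. if s = [] then Q [] h else h (hd s)"] assms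
  by (simp add: path_prefix_def)

lemma global_lower_expectation_second_state:
  fixes Q :: "'a::finite situation \<Rightarrow> 'a gamble \<Rightarrow> real"
  assumes "\<And>s. lower_expectation (Q s)"
  shows "global_lower_expectation Q (\<lambda>\<omega>. ereal (h (\<omega> 1))) = ereal (Q [] (lower_transition Q h))"
proof -
  define Y where "Y s = (case s of [] \<Rightarrow> Q [] (lower_transition Q h)
    | [x] \<Rightarrow> lower_transition Q h x | x # y # _ \<Rightarrow> h y)" for s
  have "Q s (\<lambda>x. Y (s @ [x])) = Y s" if "length s < 2" for s
    using that by (cases s) (simp_all add: Y_def lower_transition_def)
  then have "global_lower_expectation Q (\<lambda>\<omega>. ereal (Y (path_prefix \<omega> 2))) = ereal (Y [])"
    using global_lower_expectation_backward[of Q 2 Y] assms by blast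
  moreover have "Y (path_prefix \<omega> 2) = h (\<omega> 1)" for \<omega>
    by (simp add: Y_def path_prefix_def numeral_2_eq_2)
  moreover have "Y [] = Q [] (lower_transition Q h)"
    by (simp add: Y_def)
  ultimately show ?thesis by simp
qed

section \<open>Shifting submartingales in a Markov chain\<close>

lemma imprecise_markov_chain_Cons:
  assumes "imprecise_markov_chain Q" "s \<noteq> []"
  shows "Q (x # s) = Q s"
  using assms unfolding imprecise_markov_chain_def by (metis last_ConsR list.discI)

text \<open>
  Delay: no invariance is needed to transport \<open>M\<close>, only to compare the initial values.
  Beyond the second state, the condition on \<open>N\<close> at \<open>x # t\<close> is that on \<open>M\<close> at \<open>t\<close>, since the
  local model depends on the last state only.
\<close>

lemma admissible_submartingale_delay:
  fixes Q :: "'a::finite situation \<Rightarrow> 'a gamble \<Rightarrow> real"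
  assumes mc: "imprecise_markov_chain Q" and adm: "admissible_submartingale Q f M"
  obtains N where "admissible_submartingale Q (\<lambda>\<omega>. f (path_shift \<omega>)) N"
    and "N [] = Q [] (lower_transition Q (\<lambda>x. M [x]))"
proof -
  have lex: "lower_expectation (Q s)" for s
    using mc unfolding imprecise_markov_chain_def by blast
  have sub: "M s \<le> Q s (\<lambda>x. M (s @ [x]))" for s
    using adm unfolding admissible_submartingale_def submartingale_iff[OF lex] by blast
  obtain b where b: "M s \<le> b" for s
    using adm unfolding admissible_submartingale_def bdd_above_def by blast
  define m where "m x = M [x]" for x
  define N where "N s = (case s of [] \<Rightarrow> Q [] (lower_transition Q m)
    | x # t \<Rightarrow> if t = [] then lower_transition Q m x else M t)" for s
  have "submartingale Q N"
    unfolding submartingale_iff[OF lex]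
  proof
    fix s
    show "N s \<le> Q s (\<lambda>x. N (s @ [x]))"
    proof (cases s)
      case Nil
      then show ?thesis by (simp add: N_def)
    next
      case (Cons x t)
      then show ?thesis
        using sub[of t] imprecise_markov_chain_Cons[OF mc, of t x]
        by (cases "t = []") (simp_all add: N_def lower_transition_def m_def[abs_def])
    qed
  qed
  moreover have "N s \<le> b" for s
  proof -
    have "lower_transition Q m x \<le> b" for x
      unfolding lower_transition_def
      by (rule lower_expectation_le_constD[OF lex]) (simp add: m_def b)
    then show ?thesis
      by (cases s) (auto simp: N_def b intro: lower_expectation_le_constD[OF lex])
  qed
  then have "bdd_above (range N)"
    by (auto simp: bdd_above_def)
  moreover have "limsup (\<lambda>n. ereal (N (path_prefix \<omega> n))) \<le> f (path_shift \<omega>)" for \<omega>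
  proof -
    have "limsup (\<lambda>n. ereal (N (path_prefix \<omega> n))) = limsup (\<lambda>n. ereal (N (path_prefix \<omega> (n + 1))))"
      by (rule limsup_shift[symmetric])
    also have "\<dots> = limsup (\<lambda>n. ereal (M (path_prefix (path_shift \<omega>) n)))"
    proof (rule Limsup_eq)
      show "\<forall>\<^sub>F n in sequentially. ereal (N (path_prefix \<omega> (n + 1))) =
          ereal (M (path_prefix (path_shift \<omega>) n))"
        using eventually_gt_at_top[of 0]
      proof eventually_elim
        case (elim n)
        then have "path_prefix (path_shift \<omega>) n \<noteq> []"
          by (simp add: path_prefix_def)
        then show ?case
          by (simp add: path_prefix_Suc_shift N_def)
      qed
    qed
    also have "\<dots> \<le> f (path_shift \<omega>)"
      using adm unfolding admissible_submartingale_def by blast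
    finally show ?thesis .
  qed
  ultimately have "admissible_submartingale Q (\<lambda>\<omega>. f (path_shift \<omega>)) N"
    by (simp add: admissible_submartingale_def)
  moreover have "N [] = Q [] (lower_transition Q (\<lambda>x. M [x]))"
    by (simp add: N_def m_def[abs_def])
  ultimately show ?thesis by (rule that)
qed

text \<open>
  Erasing the first state: \<open>g y\<close> is the maximum of \<open>M [x, y]\<close> over \<open>x\<close>. The whole branch after \<open>y\<close>
  is taken from \<open>M\<close> after one maximising \<open>x\<close>, so a single path with shift \<open>\<omega>\<close> bounds the limit
  superior of \<open>N\<close> along \<open>\<omega>\<close> by \<open>f \<omega>\<close>.
\<close>

lemma admissible_submartingale_erase:
  fixes Q :: "'a::finite situation \<Rightarrow> 'a gamble \<Rightarrow> real"
  assumes mc: "imprecise_markov_chain Q"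
    and adm: "admissible_submartingale Q (\<lambda>\<omega>. f (path_shift \<omega>)) M"
  obtains N g where "admissible_submartingale Q f N" and "N [] = Q [] g"
    and "\<And>x y. M [x, y] \<le> g y"
proof -
  have lex: "lower_expectation (Q s)" for s
    using mc unfolding imprecise_markov_chain_def by blast
  have sub: "M s \<le> Q s (\<lambda>x. M (s @ [x]))" for s
    using adm unfolding admissible_submartingale_def submartingale_iff[OF lex] by blast
  obtain b where b: "M s \<le> b" for s
    using adm unfolding admissible_submartingale_def bdd_above_def by blast
  have "\<exists>x. \<forall>x'. M [x', y] \<le> M [x, y]" for y
  proof -
    have "Max (range (\<lambda>x. M [x, y])) \<in> range (\<lambda>x. M [x, y])"
      by (rule Max_in) auto
    then obtain x where "Max (range (\<lambda>x. M [x, y])) = M [x, y]" by blast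
    moreover have "M [x', y] \<le> Max (range (\<lambda>x. M [x, y]))" for x'
      by (rule Max_ge) auto
    ultimately show ?thesis by metis
  qed
  then obtain best where best: "M [x', y] \<le> M [best y, y]" for x' y
    by metis
  define g where "g y = M [best y, y]" for y
  define N where "N s = (if s = [] then Q [] g else M (best (hd s) # s))" for s
  have "submartingale Q N"
    unfolding submartingale_iff[OF lex]
  proof
    fix s
    show "N s \<le> Q s (\<lambda>x. N (s @ [x]))"
    proof (cases "s = []")
      case True
      then show ?thesis by (simp add: N_def g_def[abs_def])
    next
      case False
      then show ?thesis
        using sub[of "best (hd s) # s"] imprecise_markov_chain_Cons[OF mc]
        by (simp add: N_def)
    qed
  qed
  moreover have "N s \<le> b" for s
    by (auto simp: N_def g_def b intro: lower_expectation_le_constD[OF lex])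
  then have "bdd_above (range N)"
    by (auto simp: bdd_above_def)
  moreover have "limsup (\<lambda>n. ereal (N (path_prefix \<omega> n))) \<le> f \<omega>" for \<omega>
  proof -
    define \<omega>' where "\<omega>' = case_nat (best (\<omega> 0)) \<omega>"
    have shift: "path_shift \<omega>' = \<omega>"
      by (simp add: \<omega>'_def path_shift_def)
    have "limsup (\<lambda>n. ereal (N (path_prefix \<omega> n))) = limsup (\<lambda>n. ereal (M (path_prefix \<omega>' (n + 1))))"
    proof (rule Limsup_eq)
      show "\<forall>\<^sub>F n in sequentially. ereal (N (path_prefix \<omega> n)) =
          ereal (M (path_prefix \<omega>' (n + 1)))"
        using eventually_gt_at_top[of 0]
      proof eventually_elim
        case (elim n)
        then obtain k where "n = Suc k"
          using gr0_implies_Suc by blast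
        then have "path_prefix \<omega> n \<noteq> []" "hd (path_prefix \<omega> n) = \<omega> 0"
          by (simp_all add: path_prefix_Suc_shift)
        then show ?case
          using path_prefix_Suc_shift[of \<omega>' n] by (simp add: N_def shift) (simp add: \<omega>'_def)
      qed
    qed
    also have "\<dots> = limsup (\<lambda>n. ereal (M (path_prefix \<omega>' n)))"
      by (rule limsup_shift)
    also have "\<dots> \<le> f (path_shift \<omega>')"
      using adm unfolding admissible_submartingale_def by blast
    finally show ?thesis by (simp add: shift)
  qed
  ultimately have "admissible_submartingale Q f N"
    by (simp add: admissible_submartingale_def)
  moreover have "N [] = Q [] g"
    by (simp add: N_def)
  moreover have "M [x, y] \<le> g y" for x y
    by (simp add: g_def best)
  ultimately show ?thesis by (rule that)
qed

section \<open>Stationarity\<close>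

lemma stationary_chain_iff_invariant:
  fixes Q :: "'a::finite situation \<Rightarrow> 'a gamble \<Rightarrow> real"
  assumes mc: "imprecise_markov_chain Q"
  shows "stationary_chain Q \<longleftrightarrow> (\<forall>h. Q [] (lower_transition Q h) = Q [] h)"
proof -
  have lex: "lower_expectation (Q s)" for s
    using mc unfolding imprecise_markov_chain_def by blast
  show ?thesis
  proof
    assume stat: "stationary_chain Q"
    show "\<forall>h. Q [] (lower_transition Q h) = Q [] h"
    proof
      fix h
      have "global_lower_expectation Q (\<lambda>\<omega>. ereal (h (\<omega> 0))) =
          global_lower_expectation Q (\<lambda>\<omega>. ereal (h (path_shift \<omega> 0)))"
        using stat unfolding stationary_chain_def by blast
      then show "Q [] (lower_transition Q h) = Q [] h"
        using global_lower_expectation_first_state[of Q h, OF lex]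
          global_lower_expectation_second_state[of Q h, OF lex]
        by (simp add: path_shift_def)
    qed
  next
    assume inv: "\<forall>h. Q [] (lower_transition Q h) = Q [] h"
    show "stationary_chain Q"
      unfolding stationary_chain_def
    proof (intro allI antisym)
      fix f
      show "global_lower_expectation Q f \<le> global_lower_expectation Q (\<lambda>\<omega>. f (path_shift \<omega>))"
      proof (rule global_lower_expectation_least)
        fix M
        assume adm: "admissible_submartingale Q f M"
        then obtain N where N: "admissible_submartingale Q (\<lambda>\<omega>. f (path_shift \<omega>)) N"
          and "N [] = Q [] (lower_transition Q (\<lambda>x. M [x]))"
          using admissible_submartingale_delay[OF mc] by blast
        then have "N [] = Q [] (\<lambda>x. M [x])"
          using inv by simp
        moreover have "M s \<le> Q s (\<lambda>x. M (s @ [x]))" for s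
          using adm unfolding admissible_submartingale_def submartingale_iff[OF lex] by blast
        from this[of "[]"] have "M [] \<le> Q [] (\<lambda>x. M [x])" by simp
        ultimately have "M [] \<le> N []" by simp
        then show "ereal (M []) \<le> global_lower_expectation Q (\<lambda>\<omega>. f (path_shift \<omega>))"
          using global_lower_expectation_upper[OF N] by (metis ereal_less_eq(3) order_trans)
      qed
      show "global_lower_expectation Q (\<lambda>\<omega>. f (path_shift \<omega>)) \<le> global_lower_expectation Q f"
      proof (rule global_lower_expectation_least)
        fix M
        assume adm: "admissible_submartingale Q (\<lambda>\<omega>. f (path_shift \<omega>)) M"
        then obtain N g where N: "admissible_submartingale Q f N" and N0: "N [] = Q [] g"
          and g: "\<And>x y. M [x, y] \<le> g y"
          using admissible_submartingale_erase[OF mc, of f M] by blast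
        have sub: "M s \<le> Q s (\<lambda>x. M (s @ [x]))" for s
          using adm unfolding admissible_submartingale_def submartingale_iff[OF lex] by blast
        have "M [x] \<le> lower_transition Q g x" for x
          using sub[of "[x]"] lower_expectation_mono[OF lex[of "[x]"], of "\<lambda>y. M [x, y]" g] g
          by (simp add: lower_transition_def)
        then have "Q [] (\<lambda>x. M [x]) \<le> Q [] (lower_transition Q g)"
          by (rule lower_expectation_mono[OF lex])
        then have "M [] \<le> N []"
          using sub[of "[]"] inv N0 by simp
        then show "ereal (M []) \<le> global_lower_expectation Q f"
          using global_lower_expectation_upper[OF N] by (metis ereal_less_eq(3) order_trans)
      qed
    qed
  qed
qed

theorem proposition27:
  fixes Q :: "'a::finite situation \<Rightarrow> 'a gamble \<Rightarrow> real"
  assumes "imprecise_markov_chain Q"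
    and "perron_frobenius_like (lower_transition Q)"
  shows "stationary_chain Q \<longleftrightarrow> limit_expectation (lower_transition Q) = marginal_model Q"
proof -
  have "lower_expectation (Q [])"
    using assms(1) unfolding imprecise_markov_chain_def by blast
  from limit_expectation_eq_iff_invariant[OF this assms(2)] show ?thesis
    unfolding marginal_model_def stationary_chain_iff_invariant[OF assms(1)] by simp
qed

end
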